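(* Let $(Q_i,\sqsubseteq_i,\otimes_i,\mathbb{1}_i)$, $i=1,2$, be continuous quantales, $d_i$ a $Q_i$-metric on a set $X_i$, and $f:X_1\to X_2$ a function. Then the following are equivalent: (a) there exists a Scott continuous map $h:Q_1\to Q_2$ with $\mathbb{1}_2\sqsubseteq_2 h(\mathbb{1}_1)$ such that $h(d_1(x,y))\sqsubseteq_2 d_2(f(x),f(y))$ for all $x,y\in X_1$; (b) for every $\epsilon\ll\mathbb{1}_2$ there exists $\delta\ll\mathbb{1}_1$ such that for all $x\in X_1$, $f(B(x,\delta))\subseteq B(f(x),\epsilon)$.
   Context: A quantale is a complete lattice with a monoid structure $(\otimes,\mathbb{1})$ such that $\otimes$ distributes over arbitrary joins on both sides. In a complete lattice, $x\ll y$ means: for every directed $D$, $y\sqsubseteq\bigsqcup D$ implies $x\sqsubseteq d$ for some $d\in D$; the quantale is continuous if $y=\bigsqcup\{x:x\ll y\}$ for all $y$. Scott continuous means monotone and preserving directed joins. A $Q$-metric on $X$ is $d:X\times X\to Q$ with $d(x,y)\otimes d(y,z)\sqsubseteq d(x,z)$ and $\mathbb{1}\sqsubseteq d(x,x)$. Open balls are $B(x,\delta)=\{y:\delta\ll d(x,y)\}$ for $\delta\ll\mathbb{1}$ (in the relevant space). *)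

theory Defs
  imports Main "HOL-Library.FuncSet"
begin

text \<open>Directed sets are required to be nonempty.\<close>

definition (in order) directed :: "'a set \<Rightarrow> bool" where
  "directed D \<longleftrightarrow> D \<noteq> {} \<and> (\<forall>x\<in>D. \<forall>y\<in>D. \<exists>z\<in>D. x \<le> z \<and> y \<le> z)"

definition (in complete_lattice) way_below :: "'a \<Rightarrow> 'a \<Rightarrow> bool" (infix \<open>\<lless>\<close> 50) where
  "x \<lless> y \<longleftrightarrow> (\<forall>D. directed D \<longrightarrow> y \<le> Sup D \<longrightarrow> (\<exists>d\<in>D. x \<le> d))"

definition scott_continuous :: "('a::complete_lattice \<Rightarrow> 'b::complete_lattice) \<Rightarrow> bool" where
  "scott_continuous h \<longleftrightarrow> mono h \<and> (\<forall>D. directed D \<longrightarrow> h (Sup D) = Sup (h ` D))"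

text \<open>The tensor and its unit are the operations \<open>*\<close> and \<open>1\<close> of \<^class>\<open>monoid_mult\<close>;
  commutativity and integrality (\<open>1 = top\<close>) are not assumed.\<close>

class quantale = complete_lattice + monoid_mult +
  assumes Sup_mult: "Sup A * b = (SUP a\<in>A. a * b)"
    and mult_Sup: "b * Sup A = (SUP a\<in>A. b * a)"

class continuous_quantale = quantale +
  assumes Sup_way_below: "y = Sup {x. x \<lless> y}"

text \<open>Carriers are explicit sets, so that the empty space is included.\<close>

definition qmetric_on :: "'x set \<Rightarrow> ('x \<Rightarrow> 'x \<Rightarrow> 'q::quantale) \<Rightarrow> bool" where
  "qmetric_on X d \<longleftrightarrow>
     (\<forall>x\<in>X. \<forall>y\<in>X. \<forall>z\<in>X. d x y * d y z \<le> d x z) \<and> (\<forall>x\<in>X. 1 \<le> d x x)"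

definition qball :: "'x set \<Rightarrow> ('x \<Rightarrow> 'x \<Rightarrow> 'q::quantale) \<Rightarrow> 'x \<Rightarrow> 'q \<Rightarrow> 'x set" where
  "qball X d x \<delta> = {y \<in> X. \<delta> \<lless> d x y}"

end

theory Submission
  imports Defs
begin

text \<open>For the direction from balls to a Scott continuous map, the largest monotone
  candidate is \<open>g \<delta> = \<Sqinter>{d2 (f x) (f y) | \<delta> \<le> d1 x y}\<close>.  It need not preserve directed joins, but its
  lower regularisation \<open>h p = \<Squnion>{g \<delta> | \<delta> \<lless> p}\<close> does, by interpolation of the way-below relation.
  Conversely, \<open>1\<close> is the directed join of the elements way below it, so by Scott continuity
  \<open>h \<delta>\<close> exceeds a given element way below \<open>h 1\<close> for some \<open>\<delta> \<lless> 1\<close>.\<close>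

context complete_lattice
begin

lemma way_belowD: "x \<lless> y \<Longrightarrow> directed D \<Longrightarrow> y \<le> Sup D \<Longrightarrow> \<exists>d\<in>D. x \<le> d"
  by (simp add: way_below_def)

lemma directed_singleton: "directed {x}"
  by (simp add: directed_def)

lemma way_below_imp_le: "x \<lless> y \<Longrightarrow> x \<le> y"
  using way_belowD[OF _ directed_singleton] by fastforce

lemma way_below_le_trans: "x \<lless> y \<Longrightarrow> y \<le> z \<Longrightarrow> x \<lless> z"
  unfolding way_below_def by (meson order_trans)

lemma le_way_below_trans: "x \<le> y \<Longrightarrow> y \<lless> z \<Longrightarrow> x \<lless> z"
  unfolding way_below_def by (meson order_trans)

text \<open>Nonemptiness of directed sets supplies the required member \<open>d\<close>.\<close>

lemma bot_way_below: "bot \<lless> x"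
  by (auto simp: way_below_def directed_def)

lemma sup_way_below:
  assumes "x \<lless> z" and "y \<lless> z"
  shows "sup x y \<lless> z"
  unfolding way_below_def
proof (intro allI impI)
  fix D assume D: "directed D" "z \<le> Sup D"
  obtain a b where "a \<in> D" "x \<le> a" "b \<in> D" "y \<le> b"
    using assms way_belowD D by meson
  moreover from this obtain c where "c \<in> D" "a \<le> c" "b \<le> c"
    using D by (auto simp: directed_def)
  ultimately show "\<exists>d\<in>D. sup x y \<le> d"
    by (meson order_trans sup_least)
qed

text \<open>Contains \<open>bot\<close> and is closed under binary joins. Hence the join in
  \<open>Sup_way_below\<close> is directed, and Scott continuous maps preserve it.\<close>

lemma directed_way_below: "directed {x. x \<lless> y}"
  unfolding directed_def
  using bot_way_below sup_way_below sup_ge1 sup_ge2 by blast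

end

text \<open>The elements lying two way-below steps under \<open>y\<close> form a directed set.
  Continuity, applied first at each \<open>w \<lless> y\<close> and then at \<open>y\<close>, shows
  that their join is above \<open>y\<close>, so \<open>x\<close> lies below one of them.\<close>

lemma way_below_interpolate:
  fixes x y :: "'a::continuous_quantale"
  assumes "x \<lless> y"
  obtains w where "x \<lless> w" and "w \<lless> y"
proof -
  let ?D = "{u. \<exists>w. u \<lless> w \<and> w \<lless> y}"
  have "directed ?D"
    unfolding directed_def
  proof (intro conjI ballI)
    show "?D \<noteq> {}"
      using bot_way_below by blast
  next
    fix u v assume "u \<in> ?D" "v \<in> ?D"
    then obtain a b where "u \<lless> a" "a \<lless> y" "v \<lless> b" "b \<lless> y" by blast
    \<comment> \<open>The join of the two intermediate elements serves as intermediate element for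
      the upper bound \<open>sup u v\<close>.\<close>
    then have "sup u v \<lless> sup a b" "sup a b \<lless> y"
      by (auto intro!: sup_way_below intro: way_below_le_trans)
    then show "\<exists>z\<in>?D. u \<le> z \<and> v \<le> z"
      using sup_ge1 sup_ge2 by blast
  qed
  moreover have "y \<le> Sup ?D"
  proof -
    have "w \<le> Sup ?D" if "w \<lless> y" for w
    proof -
      have "Sup {u. u \<lless> w} \<le> Sup ?D"
        using that by (intro Sup_subset_mono) blast
      then show ?thesis
        by (simp add: Sup_way_below[of w, symmetric])
    qed
    then have "Sup {w. w \<lless> y} \<le> Sup ?D"
      by (intro Sup_least) simp
    then show ?thesis
      by (simp add: Sup_way_below[of y, symmetric])
  qed
  ultimately obtain u w where "x \<le> u" "u \<lless> w" "w \<lless> y"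
    using way_belowD[OF assms] by blast
  then show thesis
    using that le_way_below_trans by blast
qed

lemma directed_image:
  assumes "mono h" and "directed D"
  shows "directed (h ` D)"
  unfolding directed_def
proof (intro conjI ballI)
  show "h ` D \<noteq> {}"
    using assms(2) by (auto simp: directed_def)
next
  fix u v assume "u \<in> h ` D" "v \<in> h ` D"
  then obtain a b where "a \<in> D" "u = h a" "b \<in> D" "v = h b"
    by blast
  moreover from this obtain c where "c \<in> D" "a \<le> c" "b \<le> c"
    using assms(2) by (auto simp: directed_def)
  ultimately show "\<exists>z\<in>h ` D. u \<le> z \<and> v \<le> z"
    using monoD[OF assms(1)] by blast
qed

text \<open>Monotonicity comes from the index set growing with \<open>p\<close>; interpolation shows
  that each index way below \<open>Sup D\<close> is already way below some member of
  \<open>D\<close>.\<close>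

lemma scott_continuous_SUP_way_below:
  fixes g :: "'a::continuous_quantale \<Rightarrow> 'b::complete_lattice"
  shows "scott_continuous (\<lambda>p. SUP \<delta>\<in>{\<delta>. \<delta> \<lless> p}. g \<delta>)" (is "scott_continuous ?h")
  unfolding scott_continuous_def
proof (intro conjI allI impI)
  show mono: "mono ?h"
    by (intro monoI SUP_subset_mono) (auto intro: way_below_le_trans)
  fix D :: "'a set" assume D: "directed D"
  show "?h (Sup D) = Sup (?h ` D)"
  proof (rule antisym)
    show "?h (Sup D) \<le> Sup (?h ` D)"
    proof (rule SUP_least)
      fix \<delta> assume "\<delta> \<in> {\<delta>. \<delta> \<lless> Sup D}"
      then obtain w where "\<delta> \<lless> w" "w \<lless> Sup D"
        using way_below_interpolate by blast
      moreover from this obtain p where "p \<in> D" "w \<le> p"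
        using way_belowD[OF _ D] by blast
      ultimately have "\<delta> \<lless> p"
        by (blast intro: way_below_le_trans)
      then have "g \<delta> \<le> ?h p"
        by (blast intro: SUP_upper)
      also have "\<dots> \<le> Sup (?h ` D)"
        using \<open>p \<in> D\<close> by (rule SUP_upper)
      finally show "g \<delta> \<le> Sup (?h ` D)" .
    qed
    show "Sup (?h ` D) \<le> ?h (Sup D)"
      by (rule SUP_least) (rule monoD[OF mono Sup_upper])
  qed
qed

lemma scott_continuous_way_below_approx:
  fixes h :: "'a::continuous_quantale \<Rightarrow> 'b::continuous_quantale"
  assumes h: "scott_continuous h" and "\<epsilon> \<lless> h p"
  obtains \<delta> where "\<delta> \<lless> p" and "\<epsilon> \<lless> h \<delta>"
proof -
  \<comment> \<open>The directed join below yields only \<open>w \<le> h \<delta>\<close>; the gap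
    between \<open>\<epsilon>\<close> and \<open>w\<close> upgrades this to
    \<open>\<epsilon> \<lless> h \<delta>\<close>.\<close>
  obtain w where w: "\<epsilon> \<lless> w" "w \<lless> h p"
    using assms(2) way_below_interpolate by blast
  have "h p = Sup (h ` {\<delta>. \<delta> \<lless> p})"
  proof -
    have "h (Sup {\<delta>. \<delta> \<lless> p}) = Sup (h ` {\<delta>. \<delta> \<lless> p})"
      using h directed_way_below unfolding scott_continuous_def by blast
    then show ?thesis
      by (simp only: Sup_way_below[of p, symmetric])
  qed
  moreover have "directed (h ` {\<delta>. \<delta> \<lless> p})"
    using h by (auto simp: scott_continuous_def intro: directed_image directed_way_below)
  ultimately obtain \<delta> where "\<delta> \<lless> p" "w \<le> h \<delta>"
    using way_belowD[OF w(2)] by auto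
  then show thesis
    using that way_below_le_trans w(1) by blast
qed

theorem theorem42:
  fixes X1 :: "'x set" and d1 :: "'x \<Rightarrow> 'x \<Rightarrow> 'p::continuous_quantale"
    and X2 :: "'y set" and d2 :: "'y \<Rightarrow> 'y \<Rightarrow> 'q::continuous_quantale"
    and f :: "'x \<Rightarrow> 'y"
  assumes "qmetric_on X1 d1" and "qmetric_on X2 d2" and "f \<in> X1 \<rightarrow> X2"
  shows "(\<exists>h :: 'p \<Rightarrow> 'q. scott_continuous h \<and> 1 \<le> h 1 \<and>
            (\<forall>x\<in>X1. \<forall>y\<in>X1. h (d1 x y) \<le> d2 (f x) (f y)))
     \<longleftrightarrow> (\<forall>\<epsilon> :: 'q. \<epsilon> \<lless> 1 \<longrightarrow>
            (\<exists>\<delta> :: 'p. \<delta> \<lless> 1 \<and> (\<forall>x\<in>X1. f ` qball X1 d1 x \<delta> \<subseteq> qball X2 d2 (f x) \<epsilon>)))"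
  (is "?lhs \<longleftrightarrow> ?rhs")
proof
  assume ?lhs
  then obtain h :: "'p \<Rightarrow> 'q" where h: "scott_continuous h" "1 \<le> h 1"
    and hd: "\<And>x y. x \<in> X1 \<Longrightarrow> y \<in> X1 \<Longrightarrow> h (d1 x y) \<le> d2 (f x) (f y)"
    by blast
  show ?rhs
  proof (intro allI impI)
    fix \<epsilon> :: 'q assume "\<epsilon> \<lless> 1"
    then obtain \<delta> where \<delta>: "\<delta> \<lless> 1" "\<epsilon> \<lless> h \<delta>"
      using scott_continuous_way_below_approx[OF h(1)] way_below_le_trans[OF _ h(2)] by blast
    have "\<epsilon> \<lless> d2 (f x) (f y)" if "x \<in> X1" "y \<in> X1" "\<delta> \<lless> d1 x y" for x y
    proof -
      have "h \<delta> \<le> h (d1 x y)"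
        using h(1) that(3) by (auto simp: scott_continuous_def dest: monoD way_below_imp_le)
      then show ?thesis
        using \<delta>(2) hd[OF that(1,2)] by (blast intro: way_below_le_trans)
    qed
    then have "\<forall>x\<in>X1. f ` qball X1 d1 x \<delta> \<subseteq> qball X2 d2 (f x) \<epsilon>"
      using assms(3) by (auto simp: qball_def)
    with \<delta>(1) show "\<exists>\<delta>. \<delta> \<lless> 1 \<and> (\<forall>x\<in>X1. f ` qball X1 d1 x \<delta> \<subseteq> qball X2 d2 (f x) \<epsilon>)"
      by blast
  qed
next
  assume balls: ?rhs
  \<comment> \<open>If no pair satisfies the condition, the infimum is \<open>top\<close>.\<close>
  define g where "g \<delta> = Inf {d2 (f x) (f y) | x y. x \<in> X1 \<and> y \<in> X1 \<and> \<delta> \<le> d1 x y}" for \<delta>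
  define h where "h p = (SUP \<delta>\<in>{\<delta>. \<delta> \<lless> p}. g \<delta>)" for p
  have "scott_continuous h"
    unfolding h_def by (rule scott_continuous_SUP_way_below)
  moreover have "1 \<le> h 1"
  proof -
    have "\<epsilon> \<le> h 1" if \<epsilon>: "\<epsilon> \<lless> 1" for \<epsilon>
    proof -
      obtain \<delta> where "\<delta> \<lless> 1"
        and \<delta>: "\<forall>x\<in>X1. f ` qball X1 d1 x \<delta> \<subseteq> qball X2 d2 (f x) \<epsilon>"
        using balls[rule_format, OF \<epsilon>] by (elim exE conjE)
      \<comment> \<open>Pairs counted in \<open>g w\<close> satisfy only
        \<open>w \<le> d1 x y\<close>, while the ball asks for a way-below relation;
        \<open>\<delta> \<lless> w\<close> bridges the two, and \<open>w \<lless> 1\<close> makes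
        \<open>g w\<close> a term of \<open>h 1\<close>.\<close>
      then obtain w where w: "\<delta> \<lless> w" "w \<lless> 1"
        using way_below_interpolate by blast
      have "\<epsilon> \<le> d2 (f x) (f y)" if "x \<in> X1" "y \<in> X1" "w \<le> d1 x y" for x y
      proof -
        have "y \<in> qball X1 d1 x \<delta>"
          using that w(1) by (auto simp: qball_def intro: way_below_le_trans)
        then have "f y \<in> qball X2 d2 (f x) \<epsilon>"
          using bspec[OF \<delta> that(1)] by blast
        then show ?thesis
          by (simp add: qball_def way_below_imp_le)
      qed
      then have "\<epsilon> \<le> g w"
        unfolding g_def by (intro Inf_greatest) blast
      also have "g w \<le> h 1"
        unfolding h_def using w(2) by (blast intro: SUP_upper)
      finally show ?thesis .
    qed
    then have "Sup {\<epsilon>. \<epsilon> \<lless> 1} \<le> h 1"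
      by (intro Sup_least) simp
    then show ?thesis
      by (simp add: Sup_way_below[of "1 :: 'q", symmetric])
  qed
  \<comment> \<open>For each \<open>\<delta> \<lless> d1 x y\<close>, the pair \<open>x\<close>,
    \<open>y\<close> itself is among those over which \<open>g \<delta>\<close> takes its
    infimum.\<close>
  moreover have "h (d1 x y) \<le> d2 (f x) (f y)" if "x \<in> X1" "y \<in> X1" for x y
    unfolding h_def g_def using that
    by (intro SUP_least Inf_lower) (blast dest: way_below_imp_le)
  ultimately show ?lhs
    by blast
qed

end
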